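(* Fix $0<\alpha<\infty$ and $0<p<\infty$. If $f\in A^p_\alpha$, then $$\lim_{|w|\to1^-}|f(w)|^p(1-|w|^2)^\alpha=0.$$
   Context: $\mathbb{D}$ is the open unit disc in $\mathbb{C}$. For $f$ analytic in $\mathbb{D}$, $0<p<\infty$ and $0<r<1$, set $M_p^p(r,f)=\int_0^{2\pi}|f(re^{i\theta})|^p\,\frac{d\theta}{2\pi}$; the function $r\mapsto M_p^p(r,f)$ is increasing and differentiable on $(0,1)$. For $0<\alpha,p<\infty$ define $$\|f\|_{\alpha,p}^p=|f(0)|^p+\int_0^1\left(\frac{d}{dr}M_p^p(r,f)\right)(1-r^2)^{\alpha-1}\,dr\in[0,\infty],$$ and let $A^p_\alpha$ be the class of all analytic functions $f$ in $\mathbb{D}$ with $\|f\|_{\alpha,p}<\infty$. The limit is uniform over $w\in\mathbb{D}$ as $|w|\to1^-$, i.e. $\sup_{|w|=r}|f(w)|^p(1-|w|^2)^\alpha\to0$ as $r\to1^-$. *)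

theory Defs
  imports "HOL-Analysis.Analysis"
begin

(* M_p^p(r,f), the p-th power of the integral mean; the integrand is continuous in t
   for f analytic in the unit disc, 0 < r < 1 and p > 0. *)
definition mean_powr :: "real \<Rightarrow> real \<Rightarrow> (complex \<Rightarrow> complex) \<Rightarrow> real" where
  "mean_powr p r f =
     integral {0..2 * pi} (\<lambda>t. norm (f (of_real r * exp (\<i> * of_real t))) powr p / (2 * pi))"

(* The p-th power of the norm, with value in [0, infinity]. For f analytic in the disc,
   mean_powr p r f is increasing and differentiable in r on (0,1), so deriv is the genuine
   derivative and ennreal never truncates a negative number. *)
definition A_norm_powr :: "real \<Rightarrow> real \<Rightarrow> (complex \<Rightarrow> complex) \<Rightarrow> ennreal" where
  "A_norm_powr \<alpha> p f =
     ennreal (norm (f 0) powr p) +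
     (\<integral>\<^sup>+ r\<in>{0<..<1}.
        ennreal (deriv (\<lambda>s. mean_powr p s f) r * (1 - r\<^sup>2) powr (\<alpha> - 1)) \<partial>lborel)"

(* Functions are total on the complex plane; membership depends only on their values
   in the open unit disc. *)
definition A_space :: "real \<Rightarrow> real \<Rightarrow> (complex \<Rightarrow> complex) set" where
  "A_space \<alpha> p = {f. f analytic_on ball 0 1 \<and> A_norm_powr \<alpha> p f < \<infinity>}"

end

theory Submission
  imports Defs "HOL-Complex_Analysis.Complex_Analysis"
begin

text \<open>
  Write \<open>M r\<close> for \<open>mean_powr p r f\<close>. The idea is to replace \<open>f\<close>, on a disc of radius \<open>R < 1\<close> whose
  boundary carries no zero of \<open>f\<close>, by the holomorphic function \<open>G = (f/B) powr (p/2)\<close>, where \<open>B\<close> is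
  the finite Blaschke product of the zeros of \<open>f\<close> in that disc. Then \<open>|G|\<^sup>2 = |f| powr p\<close> on the circle
  of radius \<open>R\<close> and \<open>|f| powr p \<le> |G|\<^sup>2\<close> inside (\<open>outer_majorant_means\<close>). Hence the square means of
  \<open>G\<close> satisfy \<open>M_G R - M_G s \<le> M R - M s\<close> for \<open>s \<le> R\<close>, while Parseval's identity and the
  Cauchy--Schwarz inequality bound \<open>|G'|\<^sup>2\<close> at points of modulus less than \<open>s\<close> by an explicit multiple
  of \<open>M_G R - M_G s\<close>
  (\<open>norm_deriv_le_mean_powr_2\<close>).

  On the other hand \<open>M\<close> is the integral of its derivative, the zeros of \<open>f\<close> having only finitely many
  moduli below any \<open>R < 1\<close>. With \<open>a = min \<alpha> 1\<close>, finiteness of the norm gives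
  \<open>M R - M s \<le> e * (1 - s\<^sup>2) powr (1 - a) * (1 - R\<^sup>2) powr (a - \<alpha>)\<close> with \<open>e\<close> as small as desired
  for \<open>s\<close> near 1 (\<open>increment_bound_of_weighted_deriv\<close>). Taking \<open>1 - R\<close> comparable to \<open>1 - |w|\<close> and integrating
  the resulting bound for \<open>G'\<close> along the radius through \<open>w\<close> yields
  \<open>|f w| powr p * (1 - |w|) powr \<alpha> \<le> C * e + o(1)\<close>, where \<open>C\<close> depends only on \<open>\<alpha>\<close>
  (\<open>growth_estimate\<close>).
\<close>

section \<open>Parseval's identity and pointwise estimates for square means\<close>

lemma integral_suminf_mult:
  fixes c :: "nat \<Rightarrow> complex" and g :: "real \<Rightarrow> complex"
  assumes c: "summable (\<lambda>n. norm (c n))"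
    and u: "\<And>n. continuous_on {a..b} (u n)" "\<And>n t. t \<in> {a..b} \<Longrightarrow> norm (u n t) \<le> 1"
    and g: "continuous_on {a..b} g"
    and h: "\<And>t. t \<in> {a..b} \<Longrightarrow> (\<lambda>n. c n * u n t) sums h t"
  shows "(\<lambda>n. c n * integral {a..b} (\<lambda>t. u n t * g t)) sums integral {a..b} (\<lambda>t. h t * g t)"
proof -
  obtain B where B: "\<And>t. t \<in> {a..b} \<Longrightarrow> norm (g t) \<le> B"
    using compact_imp_bounded[OF compact_continuous_image[OF g]] by (force simp: bounded_iff)
  have bound: "norm (c n * u n t * g t) \<le> norm (c n) * B" if "t \<in> {a..b}" for n t
    using mult_mono[OF mult_mono[OF order_refl u(2)[OF that, of n]] B[OF that]]
    by (simp add: norm_mult)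
  have "uniform_limit {a..b} (\<lambda>n t. \<Sum>i<n. c i * u i t * g t) (\<lambda>t. \<Sum>i. c i * u i t * g t) sequentially"
    by (rule Weierstrass_m_test[OF bound]) (auto intro: summable_mult2 c)
  moreover have "continuous_on {a..b} (\<lambda>t. \<Sum>i<n. c i * u i t * g t)" for n
    by (intro continuous_intros u g)
  ultimately obtain I J where I: "\<And>n. ((\<lambda>t. \<Sum>i<n. c i * u i t * g t) has_integral I n) {a..b}"
    and J: "((\<lambda>t. \<Sum>i. c i * u i t * g t) has_integral J) {a..b}" and lim: "I \<longlonglongrightarrow> J"
    by (rule uniform_limit_integral[OF _ _ sequentially_bot]) auto
  have "I = (\<lambda>n. \<Sum>i<n. c i * integral {a..b} (\<lambda>t. u i t * g t))"
  proof (rule ext)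
    fix n
    have "((\<lambda>t. \<Sum>i<n. c i * (u i t * g t)) has_integral (\<Sum>i<n. c i * integral {a..b} (\<lambda>t. u i t * g t))) {a..b}"
      by (intro has_integral_sum has_integral_mult_right integrable_integral integrable_continuous_interval
          continuous_intros u g) auto
    thus "I n = (\<Sum>i<n. c i * integral {a..b} (\<lambda>t. u i t * g t))"
      using I[of n] by (simp add: mult.assoc has_integral_unique)
  qed
  moreover have "J = integral {a..b} (\<lambda>t. h t * g t)"
  proof -
    have "(\<Sum>i. c i * u i t * g t) = h t * g t" if "t \<in> {a..b}" for t
      using sums_mult2[OF h[OF that], of "g t"] by (simp add: sums_iff)
    hence "integral {a..b} (\<lambda>t. \<Sum>i. c i * u i t * g t) = integral {a..b} (\<lambda>t. h t * g t)"
      by (intro integral_cong) auto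
    thus ?thesis using J by (simp add: integral_unique)
  qed
  ultimately show ?thesis using lim unfolding sums_def by simp
qed

lemma integral_exp_powers:
  "integral {0..2*pi} (\<lambda>t. exp (\<i> * of_real t) ^ n * exp (- (\<i> * of_real t)) ^ m) =
     (if n = m then 2 * of_real pi else (0::complex))"
proof (cases "n = m")
  case True
  have "exp (\<i> * of_real t) ^ n * exp (- (\<i> * of_real t)) ^ m = (1::complex)" for t
    by (simp add: True exp_minus field_simps)
  thus ?thesis using True by (simp add: scaleR_conv_of_real)
next
  case False
  define k where "k = \<i> * (of_nat n - of_nat m)"
  have k: "k \<noteq> 0" using False by (simp add: k_def)
  have eq: "exp (\<i> * of_real t) ^ n * exp (- (\<i> * of_real t)) ^ m = exp (k * of_real t)" for t
    by (simp add: exp_of_nat_mult[symmetric] exp_add[symmetric] k_def algebra_simps)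
  have "((\<lambda>t. exp (k * of_real t)) has_integral
     exp (k * of_real (2*pi)) / k - exp (k * of_real 0) / k) {0..2*pi}"
  proof (rule fundamental_theorem_of_calculus)
    fix x :: real assume "x \<in> {0..2*pi}"
    have "((\<lambda>z. exp (k * z) / k) has_field_derivative exp (k * of_real x)) (at (of_real x))"
      using k by (auto intro!: derivative_eq_intros)
    from has_vector_derivative_real_field[OF this]
    show "((\<lambda>x. exp (k * of_real x) / k) has_vector_derivative exp (k * of_real x)) (at x within {0..2 * pi})"
      by (auto intro: has_vector_derivative_at_within)
  qed simp
  moreover have "exp (k * of_real (2*pi)) = 1"
  proof -
    have "k * of_real (2*pi) = of_int (2 * (int n - int m)) * of_real pi * \<i>"
      by (simp add: k_def)
    thus ?thesis unfolding exp_eq_1 by (auto simp: k_def intro!: exI[of _ "int n - int m"])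
  qed
  ultimately have "((\<lambda>t. exp (k * of_real t)) has_integral 0) {0..2*pi}" by simp
  thus ?thesis using False by (simp add: eq integral_unique)
qed

text \<open>Both the evaluation of the Taylor coefficients as Fourier coefficients and the final identity
  come from integrating the Taylor series on the circle term by term.\<close>

lemma parseval_mean_powr:
  assumes G: "G holomorphic_on ball 0 \<rho>" and r: "0 \<le> r" "r < \<rho>"
  shows "(\<lambda>n. (norm ((deriv ^^ n) G 0 / fact n))\<^sup>2 * r ^ (2*n)) sums mean_powr 2 r G"
proof -
  define a where "a n = (deriv ^^ n) G 0 / fact n" for n
  define e where "e t = exp (\<i> * of_real t)" for t :: real
  have ne: "norm (e t) = 1" for t by (simp add: e_def)
  have ce: "continuous_on A e" for A unfolding e_def by (intro continuous_intros)
  have cnje: "cnj (e t) = exp (- (\<i> * of_real t))" for t by (simp add: e_def exp_cnj)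
  have ps: "(\<lambda>n. a n * z ^ n) sums G z" if "norm z < \<rho>" for z
    using holomorphic_power_series[OF G, of z] that by (simp add: a_def)
  have summ: "summable (\<lambda>n. norm (a n * of_real r ^ n))"
  proof (rule powser_insidea)
    show "summable (\<lambda>n. a n * of_real ((r+\<rho>)/2) ^ n)"
      using ps[of "of_real ((r+\<rho>)/2)"] r by (intro sums_summable) (simp del: of_real_add of_real_divide)
    show "norm (of_real r :: complex) < norm (of_real ((r+\<rho>)/2) :: complex)"
      using r by (simp del: of_real_add of_real_divide)
  qed
  have expand: "(\<lambda>n. a n * of_real r ^ n * e t ^ n) sums G (of_real r * e t)" for t
    using ps[of "of_real r * e t"] r ne[of t] by (simp add: norm_mult power_mult_distrib mult_ac)
  have cG: "continuous_on {0..2*pi} (\<lambda>t. G (of_real r * e t))"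
    using holomorphic_on_imp_continuous_on[OF G]
    by (rule continuous_on_compose2) (use r ne in \<open>auto intro!: continuous_intros ce simp: norm_mult\<close>)
  have coeff: "integral {0..2*pi} (\<lambda>t. G (of_real r * e t) * cnj (e t) ^ m) = 2 * pi * (a m * of_real r ^ m)" for m
  proof -
    have "(\<lambda>n. a n * of_real r ^ n * integral {0..2*pi} (\<lambda>t. e t ^ n * cnj (e t) ^ m)) sums
           integral {0..2*pi} (\<lambda>t. G (of_real r * e t) * cnj (e t) ^ m)"
      by (rule integral_suminf_mult[OF summ])
         (use expand ne in \<open>auto intro!: continuous_intros ce simp: norm_power\<close>)
    moreover have "integral {0..2*pi} (\<lambda>t. e t ^ n * cnj (e t) ^ m) = (if n = m then 2 * of_real pi else 0)" for n
      unfolding cnje using integral_exp_powers[of n m] by (simp add: e_def)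
    ultimately have "(\<lambda>n. if n = m then a m * of_real r ^ m * (2 * of_real pi) else 0) sums
           integral {0..2*pi} (\<lambda>t. G (of_real r * e t) * cnj (e t) ^ m)"
      by (simp add: if_distrib cong: if_cong)
    from sums_unique2[OF this sums_single] show ?thesis by (simp add: mult_ac)
  qed
  have "(\<lambda>n. a n * of_real r ^ n * integral {0..2*pi} (\<lambda>t. e t ^ n * cnj (G (of_real r * e t)))) sums
           integral {0..2*pi} (\<lambda>t. G (of_real r * e t) * cnj (G (of_real r * e t)))"
    by (rule integral_suminf_mult[OF summ])
       (use expand ne cG in \<open>auto intro!: continuous_intros ce simp: norm_power\<close>)
  moreover have "integral {0..2*pi} (\<lambda>t. e t ^ n * cnj (G (of_real r * e t))) = 2 * pi * cnj (a n * of_real r ^ n)" for n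
  proof -
    have "integral {0..2*pi} (\<lambda>t. e t ^ n * cnj (G (of_real r * e t))) =
          integral {0..2*pi} (\<lambda>t. cnj (G (of_real r * e t) * cnj (e t) ^ n))"
      by (simp add: mult_ac)
    also have "\<dots> = cnj (integral {0..2*pi} (\<lambda>t. G (of_real r * e t) * cnj (e t) ^ n))"
      by (simp add: integral_cnj)
    finally show ?thesis unfolding coeff by simp
  qed
  ultimately have "(\<lambda>n. a n * of_real r ^ n * (2 * pi * cnj (a n * of_real r ^ n))) sums
           integral {0..2*pi} (\<lambda>t. G (of_real r * e t) * cnj (G (of_real r * e t)))" by simp
  moreover have terms: "a n * of_real r ^ n * (2 * pi * cnj (a n * of_real r ^ n)) / (2 * of_real pi) =
      of_real ((norm (a n))\<^sup>2 * r ^ (2*n))" for n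
    by (simp add: power_mult power2_eq_square power_mult_distrib field_simps flip: complex_norm_square)
  moreover have ends: "G (of_real r * e t) * cnj (G (of_real r * e t)) = of_real ((norm (G (of_real r * e t)))\<^sup>2)" for t
    by (rule complex_norm_square[symmetric])
  ultimately have "(\<lambda>n. a n * of_real r ^ n * (2 * pi * cnj (a n * of_real r ^ n))) sums
           integral {0..2*pi} (\<lambda>t. G (of_real r * e t) * cnj (G (of_real r * e t)))" by simp
  from sums_divide[OF this, of "2 * of_real pi"]
  have *: "(\<lambda>n. of_real ((norm (a n))\<^sup>2 * r ^ (2*n)) :: complex) sums
      (integral {0..2*pi} (\<lambda>t. of_real ((norm (G (of_real r * e t)))\<^sup>2)) / (2 * of_real pi))"
    by (simp only: terms ends)
  have "integral {0..2*pi} (\<lambda>t. of_real ((norm (G (of_real r * e t)))\<^sup>2) :: complex) / (2 * of_real pi) =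
     of_real (mean_powr 2 r G)"
  proof -
    have "((\<lambda>t. (norm (G (of_real r * e t)))\<^sup>2) has_integral
         integral {0..2*pi} (\<lambda>t. (norm (G (of_real r * e t)))\<^sup>2)) {0..2*pi}"
      by (intro integrable_integral integrable_continuous_interval continuous_intros cG)
    from has_integral_of_real[OF this, where 'b=complex] show ?thesis
      by (simp add: mean_powr_def e_def integral_unique)
  qed
  with * have "(\<lambda>n. of_real ((norm (a n))\<^sup>2 * r ^ (2*n)) :: complex) sums of_real (mean_powr 2 r G)" by simp
  hence "(\<lambda>n. (norm (a n))\<^sup>2 * r ^ (2*n)) sums mean_powr 2 r G" unfolding sums_of_real_iff .
  thus ?thesis by (simp add: a_def)
qed

lemma sums_Cauchy_Schwarz:
  fixes x :: "nat \<Rightarrow> 'a::real_normed_vector" and a b :: "nat \<Rightarrow> real"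
  assumes x: "x sums s" and a: "a sums A" and b: "b sums B"
    and nonneg: "\<And>n. 0 \<le> a n" "\<And>n. 0 \<le> b n"
    and le: "\<And>n. (norm (x n))\<^sup>2 \<le> a n * b n"
  shows "(norm s)\<^sup>2 \<le> A * B"
proof (rule LIMSEQ_le_const2)
  show "(\<lambda>n. (norm (\<Sum>i<n. x i))\<^sup>2) \<longlonglongrightarrow> (norm s)\<^sup>2"
    using x unfolding sums_def by (intro tendsto_intros)
  have "(norm (\<Sum>i<n. x i))\<^sup>2 \<le> A * B" for n
  proof -
    have "norm (x i) \<le> sqrt (a i) * sqrt (b i)" for i
      using real_le_rsqrt[OF le[of i]] by (simp add: real_sqrt_mult)
    hence "norm (\<Sum>i<n. x i) \<le> (\<Sum>i<n. sqrt (a i) * sqrt (b i))"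
      by (intro order_trans[OF norm_sum] sum_mono)
    hence "(norm (\<Sum>i<n. x i))\<^sup>2 \<le> (\<Sum>i<n. sqrt (a i) * sqrt (b i))\<^sup>2" by (intro power_mono) auto
    also have "\<dots> \<le> (\<Sum>i<n. (sqrt (a i))\<^sup>2) * (\<Sum>i<n. (sqrt (b i))\<^sup>2)" by (rule Cauchy_Schwarz_ineq_sum)
    also have "\<dots> = (\<Sum>i<n. a i) * (\<Sum>i<n. b i)" using nonneg by simp
    also have "\<dots> \<le> A * B"
      using a b nonneg by (intro mult_mono) (auto simp: sums_iff intro!: sum_le_suminf suminf_nonneg sum_nonneg)
    finally show ?thesis .
  qed
  thus "\<exists>N. \<forall>n\<ge>N. (norm (\<Sum>i<n. x i))\<^sup>2 \<le> A * B" by blast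
qed

text \<open>In the next two estimates the Taylor series of \<open>G\<close> and of its derivative are split by the
  Cauchy--Schwarz inequality, the first factor being evaluated by Parseval's identity.\<close>

lemma norm_le_mean_powr_2:
  assumes G: "G holomorphic_on ball 0 \<rho>" and R: "R < \<rho>" and v: "norm v < R"
  shows "(norm (G v))\<^sup>2 \<le> mean_powr 2 R G * (R / (R - norm v))"
proof -
  define a where "a n = (deriv ^^ n) G 0 / fact n" for n
  define q where "q = norm v / R"
  have R0: "0 < R" using v norm_ge_zero[of v] by linarith
  have q: "0 \<le> q" "q < 1" using R0 v by (auto simp: q_def)
  have q2: "q\<^sup>2 \<le> q" using q by (simp add: power2_eq_square mult_left_le)
  have ps: "(\<lambda>n. a n * v ^ n) sums G v"
    using holomorphic_power_series[OF G, of v] R v by (simp add: a_def)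
  have A: "(\<lambda>n. (norm (a n))\<^sup>2 * R ^ (2*n)) sums mean_powr 2 R G"
    unfolding a_def using parseval_mean_powr[OF G _ R] R0 by simp
  have B: "(\<lambda>n. (q\<^sup>2) ^ n) sums (1 / (1 - q\<^sup>2))"
    using q2 q by (intro geometric_sums) auto
  have "(norm (G v))\<^sup>2 \<le> mean_powr 2 R G * (1 / (1 - q\<^sup>2))"
  proof (rule sums_Cauchy_Schwarz[OF ps A B])
    fix n
    have "norm v = R * q" using R0 by (simp add: q_def)
    thus "(norm (a n * v ^ n))\<^sup>2 \<le> (norm (a n))\<^sup>2 * R ^ (2*n) * (q\<^sup>2) ^ n"
      by (simp add: norm_mult norm_power power_mult_distrib power_mult[symmetric] mult_ac)
  qed (use R0 in auto)
  also have "\<dots> \<le> mean_powr 2 R G * (1 / (1 - q))"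
  proof -
    have "0 \<le> mean_powr 2 R G" using A R0 by (intro sums_le[OF _ sums_zero A]) auto
    thus ?thesis using q2 q by (intro mult_left_mono divide_left_mono) auto
  qed
  also have "1 / (1 - q) = R / (R - norm v)" using R0 v by (simp add: q_def field_simps)
  finally show ?thesis .
qed

lemma power_Suc_diff_ge:
  fixes s R :: real
  assumes "0 \<le> s" "s \<le> R"
  shows "real (Suc m) * s ^ m * (R - s) \<le> R ^ Suc m - s ^ Suc m"
proof (induction m)
  case (Suc m)
  have "s * (real (Suc m) * s ^ m * (R - s)) \<le> R * (R ^ Suc m - s ^ Suc m)"
    using assms Suc by (intro mult_mono) auto
  thus ?case by (simp add: algebra_simps)
qed simp

text \<open>The derivative is controlled by an increment of the square mean, not only by the mean itself;
  this is what makes the hypothesis on the derivative of the means usable pointwise.\<close>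

lemma norm_deriv_le_mean_powr_2:
  assumes G: "G holomorphic_on ball 0 \<rho>" and R: "s < R" "R < \<rho>" and v: "norm v < s"
  shows "(norm (deriv G v))\<^sup>2 \<le> (mean_powr 2 R G - mean_powr 2 s G) * (s / (2 * (R - s) * (s - norm v)\<^sup>2))"
proof -
  define a where "a n = (deriv ^^ n) G 0 / fact n" for n
  define q where "q = norm v / s"
  define A where "A n = (norm (a (Suc n)))\<^sup>2 * (R ^ (2 * Suc n) - s ^ (2 * Suc n))" for n
  define B where "B n = (real (Suc n) * (q\<^sup>2) ^ n) * (1 / (2 * s * (R - s)))" for n
  have s0: "0 < s" using v norm_ge_zero[of v] by linarith
  have q: "0 \<le> q" "q < 1" using s0 v by (auto simp: q_def)
  have q2: "q\<^sup>2 \<le> q" using q by (simp add: power2_eq_square mult_left_le)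
  have ps: "(\<lambda>n. of_nat (Suc n) * a (Suc n) * v ^ n) sums deriv G v"
  proof -
    have "deriv G holomorphic_on ball 0 \<rho>" using G by (intro holomorphic_deriv) auto
    from holomorphic_power_series[OF this, of v]
    have "(\<lambda>n. (deriv ^^ n) (deriv G) 0 / fact n * v ^ n) sums deriv G v" using R v by simp
    moreover have "(deriv ^^ n) (deriv G) 0 / fact n = of_nat (Suc n) * a (Suc n)" for n
      by (simp add: a_def funpow_swap1 del: of_nat_Suc)
    ultimately show ?thesis by simp
  qed
  have A: "A sums (mean_powr 2 R G - mean_powr 2 s G)"
  proof -
    have "(\<lambda>n. (norm (a n))\<^sup>2 * R ^ (2*n) - (norm (a n))\<^sup>2 * s ^ (2*n)) sums (mean_powr 2 R G - mean_powr 2 s G)"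
      unfolding a_def using s0 R by (intro sums_diff parseval_mean_powr[OF G]) auto
    hence "(\<lambda>n. (norm (a (Suc n)))\<^sup>2 * R ^ (2 * Suc n) - (norm (a (Suc n)))\<^sup>2 * s ^ (2 * Suc n)) sums
        (mean_powr 2 R G - mean_powr 2 s G)"
      by (subst sums_Suc_iff) simp
    thus ?thesis unfolding A_def right_diff_distrib .
  qed
  have B: "B sums (1 / (1 - q\<^sup>2)\<^sup>2 * (1 / (2 * s * (R - s))))"
    unfolding B_def using q2 q by (intro sums_mult2 geometric_deriv_sums) auto
  have pow: "s ^ (2 * Suc n) \<le> R ^ (2 * Suc n)" for n using s0 R by (intro power_mono) auto
  have A_nonneg: "0 \<le> A n" for n
    unfolding A_def using pow[of n] by (intro mult_nonneg_nonneg) auto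
  \<comment> \<open>By convexity of the powers, each term of the increment of the square mean is at least
    \<open>R - s\<close> times the corresponding term of its derivative at \<open>s\<close>.\<close>
  have A_ge: "(norm (a (Suc n)))\<^sup>2 * (2 * real (Suc n) * s ^ (2*n+1) * (R - s)) \<le> A n" for n
    using power_Suc_diff_ge[of s R "2*n+1"] s0 R unfolding A_def
    by (intro mult_left_mono) (auto simp: algebra_simps)
  have "(norm (deriv G v))\<^sup>2 \<le> (mean_powr 2 R G - mean_powr 2 s G) * (1 / (1 - q\<^sup>2)\<^sup>2 * (1 / (2 * s * (R - s))))"
  proof (rule sums_Cauchy_Schwarz[OF ps A B])
    fix n
    show B0: "0 \<le> B n" using s0 R unfolding B_def by (intro mult_nonneg_nonneg) auto
    show "0 \<le> A n" by (rule A_nonneg)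
    have nv: "norm v = s * q" using s0 by (simp add: q_def)
    have "(norm (of_nat (Suc n) * a (Suc n) * v ^ n))\<^sup>2 =
        (real (Suc n))\<^sup>2 * (norm (a (Suc n)))\<^sup>2 * s ^ (2*n) * (q\<^sup>2) ^ n"
      unfolding norm_mult norm_power norm_of_nat nv by (simp add: power_mult_distrib power_mult[symmetric] mult_ac)
    also have "\<dots> = (norm (a (Suc n)))\<^sup>2 * (2 * real (Suc n) * s ^ (2*n+1) * (R - s)) * B n"
      using s0 R by (simp add: B_def power2_eq_square divide_simps del: of_nat_Suc)
    also have "\<dots> \<le> A n * B n" using A_ge B0 by (rule mult_right_mono)
    finally show "(norm (of_nat (Suc n) * a (Suc n) * v ^ n))\<^sup>2 \<le> A n * B n" .
  qed
  also have "\<dots> \<le> (mean_powr 2 R G - mean_powr 2 s G) * (1 / (1 - q)\<^sup>2 * (1 / (2 * s * (R - s))))"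
  proof -
    have "0 \<le> mean_powr 2 R G - mean_powr 2 s G" by (rule sums_le[OF A_nonneg sums_zero A])
    moreover have "(1 - q)\<^sup>2 \<le> (1 - q\<^sup>2)\<^sup>2" using q q2 by (intro power_mono) auto
    ultimately show ?thesis using s0 R q q2
      by (intro mult_left_mono mult_right_mono divide_left_mono) (auto intro!: mult_pos_pos zero_less_power)
  qed
  also have "1 / (1 - q)\<^sup>2 * (1 / (2 * s * (R - s))) = s / (2 * (R - s) * (s - norm v)\<^sup>2)"
  proof -
    have "1 - q = (s - norm v) / s" using s0 by (simp add: q_def field_simps)
    thus ?thesis using s0 by (simp add: power_divide power2_eq_square)
  qed
  finally show ?thesis .
qed

section \<open>Removing zeros without changing boundary values\<close>

lemma norm_diff_cnj_identity:
  fixes a z :: complex and R :: real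
  shows "(norm (of_real (R\<^sup>2) - cnj a * z))\<^sup>2 - R\<^sup>2 * (norm (z - a))\<^sup>2 =
         (R\<^sup>2 - (norm a)\<^sup>2) * (R\<^sup>2 - (norm z)\<^sup>2)"
proof -
  have "of_real ((norm (of_real (R\<^sup>2) - cnj a * z))\<^sup>2 - R\<^sup>2 * (norm (z - a))\<^sup>2) =
     (of_real ((R\<^sup>2 - (norm a)\<^sup>2) * (R\<^sup>2 - (norm z)\<^sup>2)) :: complex)"
    by (simp only: of_real_diff of_real_mult complex_norm_square) (simp add: algebra_simps power2_eq_square)
  thus ?thesis unfolding of_real_eq_iff .
qed

text \<open>Division by a finite Blaschke product of the disc of radius \<open>R\<close>: each factor
  \<open>z - a\<close> is replaced by \<open>(R\<^sup>2 - cnj a * z) / R\<close>, which has the same modulus for \<open>|z| = R\<close>,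
  a larger one inside, and no zero in the closed disc. The induction is on the number of zeros,
  not counted with multiplicity.\<close>

lemma zero_free_majorant:
  assumes f: "f holomorphic_on S" and S: "open S" "connected S" "cball 0 R \<subseteq> S" and R: "0 < R"
    and fin: "finite {z \<in> cball 0 R. f z = 0}"
    and bdry: "\<And>z. norm z = R \<Longrightarrow> f z \<noteq> 0"
  shows "\<exists>F. F holomorphic_on S \<and> (\<forall>z\<in>cball 0 R. F z \<noteq> 0 \<and> norm (f z) \<le> norm (F z)) \<and>
             (\<forall>z\<in>sphere 0 R. norm (F z) = norm (f z))"
  using f fin bdry
proof (induction "card {z \<in> cball 0 R. f z = 0}" arbitrary: f)
  case 0
  hence "f z \<noteq> 0" if "z \<in> cball 0 R" for z using that by auto
  with 0 show ?case by (intro exI[of _ f]) auto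
next
  case (Suc k)
  from Suc.hyps(2) obtain a where "a \<in> {z \<in> cball 0 R. f z = 0}"
    by (metis card.empty equals0I nat.distinct(1))
  hence fa: "f a = 0" and "a \<in> cball 0 R" by auto
  with Suc.prems(3)[of a] have aR: "norm a < R" by (cases "norm a = R") auto
  have aS: "a \<in> S" using S \<open>a \<in> cball 0 R\<close> by auto
  have "of_real R \<in> S" "f (of_real R) \<noteq> 0"
    using S R Suc.prems(3)[of "of_real R"] by (auto simp: subset_eq)
  hence nonconst: "\<not> f constant_on S" using fa aS unfolding constant_on_def by metis
  obtain g r n where gr: "0 < n" "0 < r" "ball a r \<subseteq> S" "g holomorphic_on ball a r"
    and fg: "\<And>w. w \<in> ball a r \<Longrightarrow> f w = (w - a)^n * g w"
    and g0: "\<And>w. w \<in> ball a r \<Longrightarrow> g w \<noteq> 0"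
    using holomorphic_factor_zero_nonconstant[OF Suc.prems(1) S(1,2) aS fa nonconst] by metis
  define h where "h z = (if z = a then g a else f z / (z - a) ^ n)" for z
  have hg: "h z = g z" if "z \<in> ball a r" for z using fg[OF that] by (auto simp: h_def)
  have "h holomorphic_on ball a r \<union> (S - {a})"
  proof (rule holomorphic_on_Un)
    show "h holomorphic_on ball a r" using gr(4) by (rule holomorphic_transform) (simp add: hg)
    have "(\<lambda>z. f z / (z - a) ^ n) holomorphic_on S - {a}"
      by (intro holomorphic_intros holomorphic_on_subset[OF Suc.prems(1)]) auto
    thus "h holomorphic_on S - {a}" by (rule holomorphic_transform) (auto simp: h_def)
  qed (use S in auto)
  moreover have "ball a r \<union> (S - {a}) = S" using gr aS by auto
  ultimately have hol_h: "h holomorphic_on S" by simp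
  have fh: "f z = (z - a) ^ n * h z" for z using fa gr(1) by (auto simp: h_def)
  have ha: "h a \<noteq> 0" using hg[of a] g0[of a] gr by auto
  define b where "b z = (of_real (R\<^sup>2) - cnj a * z) / of_real R" for z
  have b_ge: "norm (z - a) \<le> norm (b z)" if "norm z \<le> R" for z
  proof -
    have "0 \<le> (R\<^sup>2 - (norm a)\<^sup>2) * (R\<^sup>2 - (norm z)\<^sup>2)" using aR that R
      by (intro mult_nonneg_nonneg) (auto intro!: power_mono)
    hence "(R * norm (z - a))\<^sup>2 \<le> (norm (of_real (R\<^sup>2) - cnj a * z))\<^sup>2"
      unfolding norm_diff_cnj_identity[symmetric] by (simp add: power_mult_distrib)
    hence "R * norm (z - a) \<le> norm (of_real (R\<^sup>2) - cnj a * z)"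
      by (rule power2_le_imp_le) auto
    thus ?thesis using R by (simp add: b_def norm_divide field_simps)
  qed
  have b_eq: "norm (b z) = norm (z - a)" if "norm z = R" for z
  proof -
    have "(norm (of_real (R\<^sup>2) - cnj a * z))\<^sup>2 = (R * norm (z - a))\<^sup>2"
      using norm_diff_cnj_identity[of R a z] that by (simp add: power_mult_distrib)
    hence "norm (of_real (R\<^sup>2) - cnj a * z) = R * norm (z - a)"
      by (rule power2_eq_imp_eq) (use R in auto)
    thus ?thesis using R by (simp add: b_def norm_divide field_simps)
  qed
  have b0: "b z \<noteq> 0" if "norm z \<le> R" for z
  proof
    assume bz: "b z = 0"
    with b_ge[OF that] have "z = a" by simp
    with bz R have "of_real (R\<^sup>2) = cnj a * a" by (simp add: b_def)
    hence "of_real (R\<^sup>2) = (of_real ((norm a)\<^sup>2) :: complex)"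
      by (simp only: complex_norm_square mult.commute)
    hence "R\<^sup>2 = (norm a)\<^sup>2" unfolding of_real_eq_iff .
    thus False using aR R by (simp add: power2_eq_iff)
  qed
  define f1 where "f1 z = h z * b z ^ n" for z
  have hol1: "f1 holomorphic_on S"
    unfolding f1_def b_def using R by (intro holomorphic_intros hol_h) auto
  have zeros: "{z \<in> cball 0 R. f1 z = 0} = {z \<in> cball 0 R. f z = 0} - {a}"
    using b0 fh ha by (auto simp: f1_def)
  have f_f1: "norm (f z) \<le> norm (f1 z)" if "norm z \<le> R" for z
    unfolding fh[of z] f1_def norm_mult norm_power
    using power_mono[OF b_ge[OF that], of n] by (simp add: mult.commute mult_left_mono)
  have f_f1_eq: "norm (f1 z) = norm (f z)" if "norm z = R" for z
    unfolding fh[of z] f1_def norm_mult norm_power b_eq[OF that] by simp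
  have "\<exists>F. F holomorphic_on S \<and> (\<forall>z\<in>cball 0 R. F z \<noteq> 0 \<and> norm (f1 z) \<le> norm (F z)) \<and>
             (\<forall>z\<in>sphere 0 R. norm (F z) = norm (f1 z))"
  proof (rule Suc.hyps(1))
    show "k = card {z \<in> cball 0 R. f1 z = 0}"
      unfolding zeros using Suc.hyps(2) \<open>a \<in> cball 0 R\<close> fa by (subst card_Diff_singleton) auto
    show "finite {z \<in> cball 0 R. f1 z = 0}" unfolding zeros using Suc.prems(2) by simp
    show "f1 z \<noteq> 0" if "norm z = R" for z
      using f_f1_eq[OF that] Suc.prems(3)[OF that] by auto
  qed (rule hol1)
  then obtain F where F: "F holomorphic_on S"
    "\<And>z. z \<in> cball 0 R \<Longrightarrow> F z \<noteq> 0 \<and> norm (f1 z) \<le> norm (F z)"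
    "\<And>z. z \<in> sphere 0 R \<Longrightarrow> norm (F z) = norm (f1 z)" by blast
  show ?case
    by (rule exI[of _ F]) (use F f_f1 f_f1_eq in \<open>force intro: order_trans\<close>)
qed

text \<open>The function \<open>G\<close> is the power \<open>F powr (p/2)\<close> of the zero-free majorant \<open>F\<close>; it exists on a disc
  slightly larger than the one of radius \<open>R\<close> because \<open>F\<close> is zero-free on the closed disc.\<close>

lemma outer_majorant:
  assumes f: "f holomorphic_on ball 0 1" and R: "0 < R" "R < 1" and p: "0 < p"
    and bdry: "\<And>z. norm z = R \<Longrightarrow> f z \<noteq> 0"
  obtains G \<rho> where "R < \<rho>" "G holomorphic_on ball 0 \<rho>"
    "\<And>z. norm z \<le> R \<Longrightarrow> norm (f z) powr p \<le> (norm (G z))\<^sup>2"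
    "\<And>z. norm z = R \<Longrightarrow> norm (f z) powr p = (norm (G z))\<^sup>2"
proof -
  have sub: "cball 0 R \<subseteq> ball (0::complex) 1" using R by auto
  have fin: "finite {z \<in> cball 0 R. f z = 0}"
  proof (cases "f constant_on ball 0 1")
    case True
    moreover have "of_real R \<in> ball (0::complex) 1" "f (of_real R) \<noteq> 0" using R bdry[of "of_real R"] by auto
    ultimately have "f z \<noteq> 0" if "z \<in> cball 0 R" for z
      using that sub unfolding constant_on_def by (metis subsetD)
    hence "{z \<in> cball 0 R. f z = 0} = {}" by blast
    thus ?thesis by (simp only: finite.emptyI)
  next
    case False
    thus ?thesis by (intro holomorphic_compact_finite_zeros[OF f _ _ _ sub]) auto
  qed
  obtain F where F: "F holomorphic_on ball 0 1"
    "\<And>z. z \<in> cball 0 R \<Longrightarrow> F z \<noteq> 0 \<and> norm (f z) \<le> norm (F z)"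
    "\<And>z. z \<in> sphere 0 R \<Longrightarrow> norm (F z) = norm (f z)"
    using zero_free_majorant[OF f _ _ sub R(1) fin bdry] by auto
  define U where "U = {z \<in> ball 0 1. F z \<noteq> 0}"
  have "open U"
  proof -
    have "open (ball 0 1 \<inter> F -` (- {0}))"
      using holomorphic_on_imp_continuous_on[OF F(1)] by (intro continuous_open_preimage) auto
    moreover have "ball 0 1 \<inter> F -` (- {0}) = U" by (auto simp: U_def)
    ultimately show ?thesis by simp
  qed
  moreover have "cball 0 R \<subseteq> U" using F(2) sub by (auto simp: U_def)
  ultimately obtain \<epsilon> where \<epsilon>: "\<epsilon> > 0" "(\<Union>x\<in>cball 0 R. ball x \<epsilon>) \<subseteq> U"
    using compact_subset_open_imp_ball_epsilon_subset[of "cball 0 R" U] by auto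
  have bU: "ball 0 (R + \<epsilon>) \<subseteq> U"
  proof
    fix z :: complex assume z: "z \<in> ball 0 (R + \<epsilon>)"
    show "z \<in> U"
    proof (cases "norm z \<le> R")
      case True
      thus ?thesis using \<epsilon> by force
    next
      case False
      \<comment> \<open>the point of the closed disc nearest to \<open>z\<close>\<close>
      define x where "x = of_real (R / norm z) * z"
      have "z \<noteq> 0" using False less_imp_le[OF R(1)] by (intro notI) simp
      have x: "norm x = R" using \<open>z \<noteq> 0\<close> False R by (auto simp: x_def norm_mult norm_divide)
      have "z - x = of_real (1 - R / norm z) * z" by (simp add: x_def algebra_simps)
      hence "norm (z - x) = \<bar>1 - R / norm z\<bar> * norm z" by (simp add: norm_mult del: of_real_diff)
      also have "\<dots> = norm z - R" using False R \<open>z \<noteq> 0\<close> by (simp add: abs_if field_simps)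
      also have "\<dots> < \<epsilon>" using z by simp
      finally have "z \<in> ball x \<epsilon>" by (simp add: dist_norm norm_minus_commute)
      thus ?thesis using \<epsilon>(2) x by fastforce
    qed
  qed
  have "F holomorphic_on ball 0 (R + \<epsilon>)" "\<And>z. z \<in> ball 0 (R + \<epsilon>) \<Longrightarrow> F z \<noteq> 0"
    using bU holomorphic_on_subset[OF F(1)] by (auto simp: U_def subset_eq)
  from contractible_imp_holomorphic_log[OF this(1) convex_imp_contractible[OF convex_ball] this(2)]
  obtain g where g: "g holomorphic_on ball 0 (R + \<epsilon>)" "\<And>z. z \<in> ball 0 (R + \<epsilon>) \<Longrightarrow> F z = exp (g z)" by auto
  define G where "G z = exp (of_real (p/2) * g z)" for z
  have eq: "(norm (G z))\<^sup>2 = norm (F z) powr p" if "norm z \<le> R" for z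
    using g(2)[of z] \<epsilon> that by (simp add: G_def powr_def power2_eq_square flip: exp_add)
  show ?thesis
  proof (rule that)
    show "G holomorphic_on ball 0 (R + \<epsilon>)" unfolding G_def by (intro holomorphic_intros g)
    show "norm (f z) powr p \<le> (norm (G z))\<^sup>2" if "norm z \<le> R" for z
      using F(2)[of z] that p by (simp add: eq powr_mono2)
    show "norm (f z) powr p = (norm (G z))\<^sup>2" if "norm z = R" for z
      using F(3)[of z] that by (simp add: eq)
  qed (use \<epsilon> in auto)
qed

section \<open>Regularity and monotonicity of the integral means\<close>

lemma continuous_on_mean_integrand:
  assumes f: "f holomorphic_on U" and p: "0 < p" and S: "\<And>r t. r \<in> S \<Longrightarrow> of_real r * exp (\<i> * of_real t) \<in> U"
  shows "continuous_on (S \<times> T) (\<lambda>(r, t). norm (f (of_real r * exp (\<i> * of_real t))) powr p / (2 * pi))"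
proof -
  have "continuous_on (S \<times> T) (\<lambda>x. f (of_real (fst x) * exp (\<i> * of_real (snd x))))"
    using holomorphic_on_imp_continuous_on[OF f]
    by (rule continuous_on_compose2) (use S in \<open>auto intro!: continuous_intros\<close>)
  thus ?thesis unfolding split_beta using p by (intro continuous_intros continuous_on_powr') auto
qed

lemma mean_integrand_integrable:
  assumes "f holomorphic_on U" "0 < p" "cball 0 r \<subseteq> U" "0 \<le> r"
  shows "(\<lambda>t. norm (f (of_real r * exp (\<i> * of_real t))) powr p / (2 * pi)) integrable_on {0..2*pi}"
proof -
  have "continuous_on ({r} \<times> {0..2*pi}) (\<lambda>(r, t). norm (f (of_real r * exp (\<i> * of_real t))) powr p / (2 * pi))"
    using assms by (intro continuous_on_mean_integrand[OF assms(1)]) (auto simp: norm_mult subset_eq)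
  hence "continuous_on {0..2*pi} (\<lambda>t. case (r, t) of (r, t) \<Rightarrow> norm (f (of_real r * exp (\<i> * of_real t))) powr p / (2 * pi))"
    by (rule continuous_on_compose2[where f="Pair r"]) (auto intro!: continuous_intros)
  thus ?thesis by (intro integrable_continuous_interval) simp
qed

lemma continuous_on_mean_powr:
  assumes f: "f holomorphic_on ball 0 1" and p: "0 < p"
  shows "continuous_on {0..<1} (\<lambda>r. mean_powr p r f)"
proof -
  have "continuous_on ({0..<1} \<times> cbox 0 (2*pi)) (\<lambda>(r, t). norm (f (of_real r * exp (\<i> * of_real t))) powr p / (2 * pi))"
    by (rule continuous_on_mean_integrand[OF f p]) (auto simp: norm_mult)
  from integral_continuous_on_param[OF this] show ?thesis by (simp add: mean_powr_def[abs_def])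
qed

text \<open>The restriction to radii without zeros on the circle makes the integrand smooth, so that
  one may differentiate under the integral sign.\<close>

lemma mean_powr_differentiable:
  assumes f: "f holomorphic_on ball 0 1" and r: "0 < r" "r < 1" and p: "0 < p"
    and nz: "\<And>z. norm z = r \<Longrightarrow> f z \<noteq> 0"
  shows "(\<lambda>s. mean_powr p s f) field_differentiable at r"
proof -
  define e where "e t = exp (\<i> * of_real t)" for t :: real
  have ne: "norm (e t) = 1" for t by (simp add: e_def)
  have ce: "continuous_on A e" for A unfolding e_def by (intro continuous_intros)
  define V where "V = ball 0 1 \<inter> f -` (- {0})"
  have oV: "open V" unfolding V_def
    using holomorphic_on_imp_continuous_on[OF f] by (intro continuous_open_preimage) auto
  have holV: "f holomorphic_on V" "deriv f holomorphic_on V"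
    using f oV by (auto simp: V_def intro!: holomorphic_deriv intro: holomorphic_on_subset)
  have "sphere 0 r \<subseteq> V" using r nz by (auto simp: V_def)
  then obtain \<epsilon> where \<epsilon>: "\<epsilon> > 0" "(\<Union>x\<in>sphere 0 r. ball x \<epsilon>) \<subseteq> V"
    using compact_subset_open_imp_ball_epsilon_subset[of "sphere 0 r" V] oV by auto
  define U where "U = {r-\<epsilon><..<r+\<epsilon>}"
  have inV: "of_real x * e t \<in> V" if "x \<in> U" for x t
  proof -
    have "norm (of_real r * e t - of_real x * e t) = \<bar>r - x\<bar>"
      unfolding left_diff_distrib[symmetric] norm_mult ne of_real_diff[symmetric] norm_of_real by simp
    also have "\<dots> < \<epsilon>" using that by (auto simp: U_def)
    finally have "of_real x * e t \<in> ball (of_real r * e t) \<epsilon>" by (simp add: dist_norm)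
    moreover have "of_real r * e t \<in> sphere 0 r" using r by (simp add: norm_mult ne)
    ultimately show ?thesis using \<epsilon>(2) by blast
  qed
  \<comment> \<open>The integrand and its derivative in the radial variable, for \<open>x\<close> so near to \<open>r\<close> that the
    circle of radius \<open>x\<close> carries no zeros either.\<close>
  define h where "h x t = norm (f (of_real x * e t)) powr p / (2 * pi)" for x t
  define h' where "h' x t = (p * norm (f (of_real x * e t)) powr (p - 1) *
      (sgn (f (of_real x * e t)) \<bullet> (e t * deriv f (of_real x * e t)))) / (2 * pi)" for x t
  have "((\<lambda>x. integral (cbox 0 (2*pi)) (h x)) has_field_derivative integral (cbox 0 (2*pi)) (h' r)) (at r within U)"
  proof (rule leibniz_rule_field_derivative)
    fix x t assume x: "x \<in> U"
    define w where "w = of_real x * e t"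
    have w: "w \<in> V" "f w \<noteq> 0" using inV[OF x, of t] by (auto simp: w_def V_def)
    have "(f has_field_derivative deriv f w) (at w)"
      using holV(1) oV w(1) by (rule holomorphic_derivI)
    hence "((\<lambda>z. f (z * e t)) has_field_derivative deriv f w * e t) (at (of_real x))"
      unfolding w_def by (intro DERIV_chain2[where f=f]) (auto intro!: derivative_eq_intros)
    from has_vector_derivative_real_field[OF this]
    have "((\<lambda>x. f (of_real x * e t)) has_derivative (\<lambda>s. s *\<^sub>R (deriv f w * e t))) (at x)"
      by (simp add: has_vector_derivative_def)
    moreover have "(norm has_derivative (\<lambda>k. sgn (f w) \<bullet> k)) (at (f (of_real x * e t)))"
      using has_derivative_norm[of "f w"] w(2) by (simp add: w_def inner_commute)
    ultimately have "((\<lambda>x. norm (f (of_real x * e t))) has_derivative (\<lambda>s. sgn (f w) \<bullet> (s *\<^sub>R (deriv f w * e t)))) (at x)"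
      using diff_chain_at unfolding o_def by blast
    hence "((\<lambda>x. norm (f (of_real x * e t))) has_real_derivative (sgn (f w) \<bullet> (deriv f w * e t))) (at x)"
      by (simp add: has_field_derivative_def mult.commute[of "sgn (f w) \<bullet> (deriv f w * e t)"])
        (simp add: mult_commute_abs)
    from DERIV_fun_powr[OF this, of p]
    have "((\<lambda>x. h x t) has_real_derivative h' x t) (at x)"
      unfolding h_def h'_def using w by (intro DERIV_cdivide) (simp add: w_def mult_ac)
    thus "((\<lambda>x. h x t) has_real_derivative h' x t) (at x within U)"
      by (rule has_field_derivative_at_within)
  next
    fix x assume "x \<in> U"
    have "continuous_on ({x} \<times> cbox 0 (2*pi)) (\<lambda>(r, t). h r t)"
      unfolding h_def e_def
      by (rule continuous_on_mean_integrand[OF holV(1) p]) (use inV[OF \<open>x \<in> U\<close>] in \<open>auto simp: e_def\<close>)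
    hence "continuous_on (cbox 0 (2*pi)) (\<lambda>t. case (x, t) of (r, t) \<Rightarrow> h r t)"
      by (rule continuous_on_compose2[where f="Pair x"]) (auto intro!: continuous_intros)
    thus "h x integrable_on cbox 0 (2*pi)"
      by (intro integrable_continuous) simp
  next
    have c1: "continuous_on (U \<times> cbox 0 (2*pi)) (\<lambda>x. f (of_real (fst x) * e (snd x)))"
      using holomorphic_on_imp_continuous_on[OF holV(1)]
      by (rule continuous_on_compose2) (use inV in \<open>auto intro!: continuous_intros continuous_on_compose2[OF ce[of UNIV]]\<close>)
    have c2: "continuous_on (U \<times> cbox 0 (2*pi)) (\<lambda>x. deriv f (of_real (fst x) * e (snd x)))"
      using holomorphic_on_imp_continuous_on[OF holV(2)]
      by (rule continuous_on_compose2) (use inV in \<open>auto intro!: continuous_intros continuous_on_compose2[OF ce[of UNIV]]\<close>)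
    have c3: "continuous_on (U \<times> cbox 0 (2*pi)) (\<lambda>x. e (snd x))"
      by (auto intro!: continuous_intros continuous_on_compose2[OF ce[of UNIV]])
    have "\<forall>x\<in>U \<times> cbox 0 (2*pi). f (of_real (fst x) * e (snd x)) \<noteq> 0"
      using inV by (auto simp: V_def)
    thus "continuous_on (U \<times> cbox 0 (2*pi)) (\<lambda>(x, t). h' x t)"
      unfolding h'_def split_beta sgn_div_norm by (intro continuous_intros c1 c2 c3) auto
  qed (use \<epsilon> in \<open>auto simp: U_def\<close>)
  moreover have "at r within U = at r" using \<epsilon> by (intro at_within_open) (auto simp: U_def)
  ultimately show ?thesis
    unfolding field_differentiable_def h_def e_def mean_powr_def[abs_def] by auto
qed

text \<open>Passing from \<open>f\<close> to \<open>G\<close> keeps the mean at radius \<open>R\<close> and increases the smaller ones, so that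
  increments of the square mean of \<open>G\<close> up to \<open>R\<close> are bounded by those of the mean of \<open>f\<close>.\<close>

lemma outer_majorant_means:
  assumes f: "f holomorphic_on ball 0 1" and R: "0 < R" "R < 1" and p: "0 < p"
    and bdry: "\<And>z. norm z = R \<Longrightarrow> f z \<noteq> 0"
  obtains G \<rho> where "R < \<rho>" "G holomorphic_on ball 0 \<rho>"
    "\<And>z. norm z \<le> R \<Longrightarrow> norm (f z) powr p \<le> (norm (G z))\<^sup>2"
    "\<And>s. 0 \<le> s \<Longrightarrow> s \<le> R \<Longrightarrow> mean_powr p s f \<le> mean_powr 2 s G"
    "mean_powr p R f = mean_powr 2 R G"
proof -
  obtain G \<rho> where G: "R < \<rho>" "G holomorphic_on ball 0 \<rho>"
    and le: "\<And>z. norm z \<le> R \<Longrightarrow> norm (f z) powr p \<le> (norm (G z))\<^sup>2"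
    and eq: "\<And>z. norm z = R \<Longrightarrow> norm (f z) powr p = (norm (G z))\<^sup>2"
    using outer_majorant[OF f R p bdry] by metis
  show ?thesis
  proof (rule that[OF G])
    show "norm (f z) powr p \<le> (norm (G z))\<^sup>2" if "norm z \<le> R" for z
      by (rule le[OF that])
    show "mean_powr p s f \<le> mean_powr 2 s G" if "0 \<le> s" "s \<le> R" for s
      unfolding mean_powr_def
      by (intro integral_le mean_integrand_integrable[OF f p] mean_integrand_integrable[OF G(2)]
          divide_right_mono)
         (use that R G in \<open>auto simp: norm_mult intro!: le\<close>)
    show "mean_powr p R f = mean_powr 2 R G"
      unfolding mean_powr_def using R by (intro integral_cong) (simp add: eq norm_mult)
  qed
qed

lemma mean_powr_2_mono:
  assumes G: "G holomorphic_on ball 0 \<rho>" and "0 \<le> s" "s \<le> R" "R < \<rho>"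
  shows "mean_powr 2 s G \<le> mean_powr 2 R G"
  by (rule sums_le[OF _ parseval_mean_powr[OF G] parseval_mean_powr[OF G]])
     (use assms in \<open>auto intro!: mult_left_mono power_mono\<close>)

lemma mean_powr_le_zero_free_radius:
  assumes f: "f holomorphic_on ball 0 1" and R: "0 < R" "R < 1" and p: "0 < p"
    and bdry: "\<And>z. norm z = R \<Longrightarrow> f z \<noteq> 0" and s: "0 \<le> s" "s \<le> R"
  shows "mean_powr p s f \<le> mean_powr p R f"
proof -
  obtain G \<rho> where G: "R < \<rho>" "G holomorphic_on ball 0 \<rho>"
    "mean_powr p s f \<le> mean_powr 2 s G" "mean_powr p R f = mean_powr 2 R G"
    using outer_majorant_means[OF f R p bdry] s by metis
  thus ?thesis using mean_powr_2_mono[OF G(2) s G(1)] by linarith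
qed

lemma deriv_mean_powr_nonneg:
  assumes f: "f holomorphic_on ball 0 1" and r: "0 < r" "r < 1" and p: "0 < p"
    and nz: "\<And>z. norm z = r \<Longrightarrow> f z \<noteq> 0"
  shows "0 \<le> deriv (\<lambda>s. mean_powr p s f) r"
proof (rule ccontr)
  assume "\<not> ?thesis"
  moreover have "((\<lambda>s. mean_powr p s f) has_real_derivative deriv (\<lambda>s. mean_powr p s f) r) (at r)"
    using mean_powr_differentiable[OF assms] by (rule field_differentiable_derivI)
  ultimately obtain d where d: "0 < d" "\<And>h. 0 < h \<Longrightarrow> h < d \<Longrightarrow> mean_powr p r f < mean_powr p (r - h) f"
    using DERIV_neg_dec_left by (metis not_le)
  define h where "h = min d r / 2"
  have "0 < h" "h < d" "h < r" using d(1) r by (auto simp: h_def)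
  with d(2)[of h] mean_powr_le_zero_free_radius[OF f r p nz, of "r - h"] show False by simp
qed

section \<open>Increments controlled by a weighted integral of the derivative\<close>

text \<open>A function \<open>M\<close> that is continuous, and differentiable with nonnegative derivative off a
  set \<open>Z\<close> with finitely many elements in each \<open>(0, r]\<close>, \<open>r < 1\<close>, is the integral of its derivative. For
  \<open>s \<le> r \<le> R\<close> the weight \<open>(1 - r\<^sup>2) powr (\<alpha> - 1)\<close> is at least the reciprocal of
  \<open>(1 - s\<^sup>2) powr (1 - a) * (1 - R\<^sup>2) powr (a - \<alpha>)\<close>, and the tail of the weighted integral is small.\<close>

lemma increment_bound_of_weighted_deriv:
  fixes M D :: "real \<Rightarrow> real" and \<alpha> a e :: real
  assumes cont: "continuous_on {0<..<1} M"
    and Z: "\<And>r. r < 1 \<Longrightarrow> finite (Z \<inter> {0<..r})"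
    and deriv: "\<And>r. r \<in> {0<..<1} - Z \<Longrightarrow> (M has_real_derivative D r) (at r)"
    and nonneg: "\<And>r. r \<in> {0<..<1} - Z \<Longrightarrow> 0 \<le> D r"
    and fin: "(\<integral>\<^sup>+ r\<in>{0<..<1}. ennreal (D r * (1 - r\<^sup>2) powr (\<alpha> - 1)) \<partial>lborel) < \<infinity>"
    and a: "a \<le> 1" "a \<le> \<alpha>" and e: "0 < e"
  shows "\<exists>s0\<in>{0<..<1}. \<forall>s R. s0 < s \<longrightarrow> s \<le> R \<longrightarrow> R < 1 \<longrightarrow>
           M R - M s \<le> e * ((1 - s\<^sup>2) powr (1 - a) * (1 - R\<^sup>2) powr (a - \<alpha>))"
proof -
  define Z' where "Z' = Z \<inter> {0<..<1}"
  have countZ: "countable Z'"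
  proof -
    have "Z' \<subseteq> (\<Union>n. Z \<inter> {0<..1 - 1 / real (Suc n)})"
    proof
      fix x assume x: "x \<in> Z'"
      then obtain n where "1 / real (Suc n) < 1 - x"
        using nat_approx_posE[of "1 - x"] by (auto simp: Z'_def)
      with x show "x \<in> (\<Union>n. Z \<inter> {0<..1 - 1 / real (Suc n)})"
        by (intro UN_I[of n]) (auto simp: Z'_def)
    qed
    moreover have "finite (Z \<inter> {0<..1 - 1 / real (Suc n)})" for n by (rule Z) simp
    hence "countable (\<Union>n. Z \<inter> {0<..1 - 1 / real (Suc n)})"
      by (intro countable_UN countableI_type countable_finite)
    ultimately show ?thesis by (rule countable_subset)
  qed
  define E where "E = {0<..<1} - Z'"
  have EZ: "E = {0<..<1} - Z" by (auto simp: E_def Z'_def)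
  have [measurable]: "E \<in> sets borel"
    unfolding E_def by (rule sets.Diff[OF _ sets.countable[OF _ countZ]]) auto
  define D1 where "D1 r = indicator E r * D r" for r
  have D1_nonneg: "0 \<le> D1 r" for r using nonneg EZ by (auto simp: D1_def indicator_def)
  \<comment> \<open>The derivative is a limit of difference quotients of \<open>M\<close> extended by zero.\<close>
  have [measurable]: "D1 \<in> borel_measurable borel"
  proof (rule borel_measurable_LIMSEQ_real)
    define M1 where "M1 x = indicator {0<..<1} x *\<^sub>R M x" for x :: real
    have [measurable]: "M1 \<in> borel_measurable borel"
      unfolding M1_def[abs_def] by (rule borel_measurable_continuous_on_indicator[OF _ cont]) auto
    show "(\<lambda>x. indicator E x * ((M1 (x + 1 / real (Suc n)) - M1 x) / (1 / real (Suc n)))) \<in> borel_measurable borel" for n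
      by measurable
    show "(\<lambda>n. indicator E x * ((M1 (x + 1 / real (Suc n)) - M1 x) / (1 / real (Suc n)))) \<longlonglongrightarrow> D1 x" for x
    proof (cases "x \<in> E")
      case True
      have "(M has_real_derivative D x) (at x)" using deriv True EZ by auto
      hence "(M1 has_real_derivative D x) (at x)"
        by (rule has_field_derivative_transform_within_open[where S="{0<..<1}"])
           (use True in \<open>auto simp: M1_def E_def\<close>)
      hence "((\<lambda>h. (M1 (x + h) - M1 x) / h) \<longlongrightarrow> D x) (at 0)" by (simp add: DERIV_def)
      moreover have "filterlim (\<lambda>n. 1 / real (Suc n)) (at 0) sequentially"
        using LIMSEQ_inverse_real_of_nat by (auto simp: filterlim_at inverse_eq_divide)
      ultimately have "(\<lambda>n. (M1 (x + 1 / real (Suc n)) - M1 x) / (1 / real (Suc n))) \<longlonglongrightarrow> D x"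
        by (rule filterlim_compose)
      thus ?thesis using True by (simp add: D1_def)
    qed (simp add: D1_def)
  qed
  define W where "W r = (1 - r\<^sup>2) powr (\<alpha> - 1)" for r :: real
  have [measurable]: "W \<in> borel_measurable borel" unfolding W_def by measurable
  define g where "g r = ennreal (D1 r * W r)" for r
  have [measurable]: "g \<in> borel_measurable borel" unfolding g_def by measurable
  define \<mu> where "\<mu> = density lborel g"
  have \<mu>: "emeasure \<mu> {s<..<1} = (\<integral>\<^sup>+ r\<in>{s<..<1}. g r \<partial>lborel)" for s
    unfolding \<mu>_def by (subst emeasure_density) auto
  have "(\<integral>\<^sup>+ r\<in>{0<..<1}. ennreal (D r * (1 - r\<^sup>2) powr (\<alpha> - 1)) \<partial>lborel) =
        (\<integral>\<^sup>+ r\<in>{0<..<1}. g r \<partial>lborel)"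
  proof (rule nn_integral_cong_AE)
    have "AE r in lborel. r \<notin> Z'"
      using countable_imp_null_set_lborel[OF countZ] by (rule AE_not_in)
    thus "AE r in lborel. ennreal (D r * (1 - r\<^sup>2) powr (\<alpha> - 1)) * indicator {0<..<1} r = g r * indicator {0<..<1} r"
      by eventually_elim (auto simp: g_def D1_def W_def E_def indicator_def)
  qed
  with fin \<mu>[of 0] have \<mu>_fin: "emeasure \<mu> {0<..<1} < \<infinity>" by simp
  define c where "c n = 1 - 1 / real (n + 2)" for n
  have c: "c n \<in> {0<..<1}" for n by (auto simp: c_def field_simps)
  have "(\<lambda>n. emeasure \<mu> {c n<..<1}) \<longlonglongrightarrow> emeasure \<mu> (\<Inter>n. {c n<..<1})"
  proof (rule Lim_emeasure_decseq)
    have "c n \<le> c (Suc n)" for n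
      unfolding c_def by (intro diff_left_mono divide_left_mono) auto
    thus "decseq (\<lambda>n. {c n<..<1})" by (intro decseq_SucI) (meson greaterThanLessThan_subseteq_greaterThanLessThan order_refl)
    show "emeasure \<mu> {c n<..<1} \<noteq> \<infinity>" for n
    proof -
      have "emeasure \<mu> {c n<..<1} \<le> emeasure \<mu> {0<..<1}"
        using c[of n] by (intro emeasure_mono) (auto simp: \<mu>_def)
      thus ?thesis using \<mu>_fin by (auto simp: top_unique)
    qed
  qed (auto simp: \<mu>_def)
  moreover have "(\<Inter>n. {c n<..<1}) = {}"
  proof -
    have "x \<notin> (\<Inter>n. {c n<..<1})" for x
    proof
      assume x: "x \<in> (\<Inter>n. {c n<..<1})"
      hence "x < 1" by auto
      then obtain n where n: "1 / real (Suc n) < 1 - x"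
        using nat_approx_posE[of "1 - x"] by auto
      have "1 / real (n + 2) \<le> 1 / real (Suc n)" by (intro divide_left_mono) auto
      hence "x < c n" using n unfolding c_def by linarith
      moreover have "c n < x" using INT_D[OF x, of n] by simp
      ultimately show False by simp
    qed
    thus ?thesis by blast
  qed
  ultimately have "(\<lambda>n. emeasure \<mu> {c n<..<1}) \<longlonglongrightarrow> 0" by simp
  hence "eventually (\<lambda>n. emeasure \<mu> {c n<..<1} < ennreal e) sequentially"
    using e by (intro order_tendstoD) auto
  then obtain n where n: "emeasure \<mu> {c n<..<1} < ennreal e"
    using eventually_happens'[OF sequentially_bot] by blast
  show ?thesis
  proof (intro bexI[of _ "c n"] allI impI c)
    fix s R assume sR: "c n < s" "s \<le> R" "R < 1"
    have s0: "0 < s" using sR c[of n] by auto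
    define K where "K = (1 - s\<^sup>2) powr (1 - a) * (1 - R\<^sup>2) powr (a - \<alpha>)"
    have K0: "0 \<le> K" by (simp add: K_def)
    have WK: "1 \<le> K * W r" if r: "s \<le> r" "r \<le> R" for r
    proof -
      have r2: "0 < 1 - r\<^sup>2" "1 - R\<^sup>2 \<le> 1 - r\<^sup>2" "1 - r\<^sup>2 \<le> 1 - s\<^sup>2" "0 < 1 - R\<^sup>2"
      proof -
        have "s\<^sup>2 \<le> r\<^sup>2" "r\<^sup>2 \<le> R\<^sup>2" using r s0 by (auto intro!: power_mono)
        moreover have "R\<^sup>2 < 1" using sR s0 by (simp add: abs_square_less_1)
        ultimately show "0 < 1 - r\<^sup>2" "1 - R\<^sup>2 \<le> 1 - r\<^sup>2" "1 - r\<^sup>2 \<le> 1 - s\<^sup>2" "0 < 1 - R\<^sup>2"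
          by auto
      qed
      have "(1 - r\<^sup>2) powr (1 - a) \<le> (1 - s\<^sup>2) powr (1 - a)"
        using r2 a by (intro powr_mono2) auto
      moreover have "(1 - r\<^sup>2) powr (a - \<alpha>) \<le> (1 - R\<^sup>2) powr (a - \<alpha>)"
        using r2 a by (intro powr_mono2') auto
      ultimately have "(1 - r\<^sup>2) powr (1 - a) * (1 - r\<^sup>2) powr (a - \<alpha>) \<le> K"
        unfolding K_def by (intro mult_mono) auto
      hence "(1 - r\<^sup>2) powr (1 - a) * (1 - r\<^sup>2) powr (a - \<alpha>) * W r \<le> K * W r"
        by (intro mult_right_mono) (auto simp: W_def)
      moreover have "(1 - r\<^sup>2) powr (1 - a) * (1 - r\<^sup>2) powr (a - \<alpha>) * W r = 1"
        using r2 by (simp add: W_def flip: powr_add)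
      ultimately show ?thesis by simp
    qed
    have "(D1 has_integral (M R - M s)) {s..R}"
    proof (rule fundamental_theorem_of_calculus_interior_strong)
      show "finite (Z \<inter> {0<..R})" using Z sR by blast
      show "(M has_vector_derivative D1 x) (at x)" if "x \<in> {s<..<R} - Z \<inter> {0<..R}" for x
      proof -
        have "x \<in> E" using that s0 sR by (auto simp: EZ)
        thus ?thesis using deriv[of x] EZ
          by (auto simp: D1_def simp flip: has_real_derivative_iff_has_vector_derivative)
      qed
      show "continuous_on {s..R} M" using s0 sR by (intro continuous_on_subset[OF cont]) auto
    qed (use sR in auto)
    hence "ennreal (M R - M s) = (\<integral>\<^sup>+ r\<in>{s..R}. ennreal (D1 r) \<partial>lborel)"
      by (intro nn_integral_has_integral_lebesgue'[symmetric] D1_nonneg)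
    also have "\<dots> \<le> (\<integral>\<^sup>+ r. ennreal K * (g r * indicator {c n<..<1} r) \<partial>lborel)"
    proof (rule nn_integral_mono)
      fix r
      show "ennreal (D1 r) * indicator {s..R} r \<le> ennreal K * (g r * indicator {c n<..<1} r)"
      proof (cases "r \<in> {s..R}")
        case True
        have "D1 r \<le> D1 r * (K * W r)" 
          using mult_left_mono[OF WK[of r] D1_nonneg[of r]] True by simp
        hence "ennreal (D1 r) \<le> ennreal (K * (D1 r * W r))" by (simp add: ennreal_leI mult_ac)
        also have "\<dots> = ennreal K * g r" unfolding g_def using K0 by (simp add: ennreal_mult')
        finally show ?thesis using True sR by (simp add: indicator_def)
      qed simp
    qed
    also have "\<dots> = ennreal K * emeasure \<mu> {c n<..<1}"
      unfolding \<mu> by (rule nn_integral_cmult) measurable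
    also have "\<dots> \<le> ennreal K * ennreal e" using n by (intro mult_left_mono) auto
    also have "\<dots> = ennreal (e * K)" using K0 e by (simp add: ennreal_mult'' mult.commute)
    finally show "M R - M s \<le> e * ((1 - s\<^sup>2) powr (1 - a) * (1 - R\<^sup>2) powr (a - \<alpha>))"
      using K0 e by (simp add: K_def ennreal_le_iff)
  qed
qed

section \<open>The growth estimate and its limit\<close>

lemma norm_le_radial:
  assumes G: "G holomorphic_on ball 0 \<rho>" and w: "norm w < \<rho>" "norm w < 1" and s: "0 < s" "s < norm w"
    and a: "0 < a"
    and G': "\<And>v. s \<le> norm v \<Longrightarrow> norm v \<le> norm w \<Longrightarrow> norm (deriv G v) \<le> K * (1 - norm v) powr (-a/2 - 1)"
    and K: "0 \<le> K"
  shows "norm (G w) \<le> norm (G (of_real (s / norm w) * w)) + K * (2/a) * (1 - norm w) powr (-a/2)"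
proof -
  define u where "u = w / of_real (norm w)"
  have w0: "norm w > 0" using s by linarith
  have u: "norm u = 1" using w0 by (simp add: u_def norm_divide)
  have wu: "w = of_real (norm w) * u" using w0 by (simp add: u_def)
  have su: "of_real (s / norm w) * w = of_real s * u" by (simp add: u_def)
  have nu: "norm (of_real x * u) = x" if "x \<in> {s..norm w}" for x using that s u by (simp add: norm_mult)
  have vd: "((\<lambda>x. G (of_real x * u)) has_vector_derivative (deriv G (of_real x * u) * u)) (at x)"
    if x: "x \<in> {s..norm w}" for x
  proof -
    have "(G has_field_derivative deriv G (of_real x * u)) (at (of_real x * u))"
      using G nu[OF x] w x by (intro holomorphic_derivI[OF G]) auto
    hence "((\<lambda>z. G (z * u)) has_field_derivative deriv G (of_real x * u) * u) (at (of_real x))"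
      by (intro DERIV_chain2[where f=G]) (auto intro!: derivative_eq_intros)
    thus ?thesis by (rule has_vector_derivative_real_field)
  qed
  define \<phi> where "\<phi> x = K * (2/a) * (1 - x) powr (-a/2)" for x
  have \<phi>': "(\<phi> has_vector_derivative K * (1 - x) powr (-a/2 - 1)) (at x)" if "x \<in> {s..norm w}" for x
    unfolding \<phi>_def has_real_derivative_iff_has_vector_derivative[symmetric]
    using that w a by (auto intro!: derivative_eq_intros simp: field_simps)
  have "norm (G (of_real (norm w) * u) - G (of_real s * u)) \<le> \<phi> (norm w) - \<phi> s"
  proof (rule differentiable_bound_general[OF s(2)])
    show "continuous_on {s..norm w} \<phi>"
      using \<phi>' by (intro continuous_at_imp_continuous_on) (blast intro: has_vector_derivative_continuous)
    show "continuous_on {s..norm w} (\<lambda>x. G (of_real x * u))"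
      using vd by (intro continuous_at_imp_continuous_on) (blast intro: has_vector_derivative_continuous)
    show "((\<lambda>x. G (of_real x * u)) has_vector_derivative deriv G (of_real x * u) * u) (at x)"
      if "s < x" "x < norm w" for x using that by (intro vd) auto
    show "(\<phi> has_vector_derivative K * (1 - x) powr (-a/2 - 1)) (at x)"
      if "s < x" "x < norm w" for x using that by (intro \<phi>') auto
    show "norm (deriv G (of_real x * u) * u) \<le> K * (1 - x) powr (-a/2 - 1)" if "s < x" "x < norm w" for x
      using G'[of "of_real x * u"] nu[of x] that u by (simp add: norm_mult)
  qed
  moreover have "0 \<le> \<phi> s" using K a by (simp add: \<phi>_def)
  moreover have "norm (G w) \<le> norm (G (of_real s * u)) + norm (G (of_real (norm w) * u) - G (of_real s * u))"
    using norm_triangle_ineq[of "G (of_real s * u)" "G (of_real (norm w) * u) - G (of_real s * u)"] wu by simp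
  ultimately show ?thesis unfolding su \<phi>_def by linarith
qed

text \<open>The main estimate. The auxiliary radius \<open>R\<close> is chosen with \<open>1 - R\<close> comparable to
  \<open>\<delta> = 1 - |w|\<close>. At a point \<open>v\<close> with \<open>s1 \<le> |v| \<le> |w|\<close> the increment of the means between the midpoint \<open>s\<close> of
  \<open>|v|\<close> and \<open>R\<close> and the radius \<open>R\<close> bounds \<open>|G'(v)|\<close> by a multiple of
  \<open>\<delta> powr ((a - \<alpha>)/2) * (1 - |v|) powr (- a/2 - 1)\<close>. As \<open>a > 0\<close>, integration along the radius loses
  nothing and gives the order \<open>\<delta> powr (- \<alpha>/2)\<close>. The explicit constants play no role.\<close>

lemma growth_estimate:
  assumes f: "f holomorphic_on ball 0 1" and p: "0 < p"
    and Z: "\<And>r. r < 1 \<Longrightarrow> finite (norm ` {z. f z = 0} \<inter> {0<..r})"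
    and a: "0 < a" "a \<le> 1" "a \<le> \<alpha>" and e: "0 < e" and s1: "0 < s1"
    and incr: "\<And>s R. s1 \<le> s \<Longrightarrow> s \<le> R \<Longrightarrow> R < 1 \<Longrightarrow>
        mean_powr p R f - mean_powr p s f \<le> e * ((1 - s\<^sup>2) powr (1 - a) * (1 - R\<^sup>2) powr (a - \<alpha>))"
    and w: "s1 < norm w" "norm w < 1"
  shows "norm (f w) powr p * (1 - norm w) powr \<alpha> \<le>
    4 / (1 - s1) * (mean_powr p s1 f * (1 - norm w) powr \<alpha> + e * 4 powr \<alpha> * (1 - norm w) powr a)
    + 512 * 4 powr \<alpha> * e / a\<^sup>2"
proof -
  define \<delta> where "\<delta> = 1 - norm w"
  have nw: "norm w = 1 - \<delta>" by (simp add: \<delta>_def)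
  have \<delta>: "0 < \<delta>" "\<delta> < 1 - s1" using w by (auto simp: \<delta>_def)
  \<comment> \<open>All but finitely many radii below \<open>1 - \<delta>/4\<close> have no zero of \<open>f\<close> on their circle.\<close>
  obtain R where R: "1 - \<delta>/2 < R" "R < 1 - \<delta>/4" and bdry: "\<And>z. norm z = R \<Longrightarrow> f z \<noteq> 0"
  proof -
    have "infinite ({1 - \<delta>/2<..<1 - \<delta>/4} - norm ` {z. f z = 0} \<inter> {0<..1 - \<delta>/4})"
      using \<delta> by (intro Diff_infinite_finite Z) (auto simp: infinite_Ioo)
    then obtain R where "R \<in> {1 - \<delta>/2<..<1 - \<delta>/4} - norm ` {z. f z = 0} \<inter> {0<..1 - \<delta>/4}"
      by (metis ex_in_conv finite.emptyI)
    with \<delta> s1 show ?thesis by (intro that[of R]) (auto simp: image_iff)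
  qed
  have R01: "0 < R" "R < 1" "norm w < R" using R \<delta> s1 nw by - linarith+
  obtain G \<rho> where G: "R < \<rho>" "G holomorphic_on ball 0 \<rho>"
    and fG: "\<And>z. norm z \<le> R \<Longrightarrow> norm (f z) powr p \<le> (norm (G z))\<^sup>2"
    and MG: "\<And>s. 0 \<le> s \<Longrightarrow> s \<le> R \<Longrightarrow> mean_powr p s f \<le> mean_powr 2 s G"
    and MGR: "mean_powr p R f = mean_powr 2 R G"
    using outer_majorant_means[OF f R01(1,2) p bdry] by metis
  have R2: "\<delta>/4 \<le> 1 - R\<^sup>2"
  proof -
    have "R\<^sup>2 \<le> R" using R01 by (simp add: power2_eq_square mult_left_le)
    thus ?thesis using R by linarith
  qed
  have Rpow: "(1 - R\<^sup>2) powr (a - \<alpha>) \<le> 4 powr \<alpha> * \<delta> powr (a - \<alpha>)"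
  proof -
    have "(1 - R\<^sup>2) powr (a - \<alpha>) \<le> (\<delta>/4) powr (a - \<alpha>)"
      using R2 \<delta> a by (intro powr_mono2') auto
    also have "\<dots> = 4 powr (\<alpha> - a) * \<delta> powr (a - \<alpha>)"
      using \<delta> by (simp add: powr_divide powr_minus_divide[of 4 "\<alpha> - a", simplified] field_simps flip: powr_add)
    also have "\<dots> \<le> 4 powr \<alpha> * \<delta> powr (a - \<alpha>)" using a by (intro mult_right_mono powr_mono) auto
    finally show ?thesis .
  qed
  define B where "B = 64 * 4 powr \<alpha> * e * \<delta> powr (a - \<alpha>)"
  have B0: "0 \<le> B" using e by (simp add: B_def)
  have G': "norm (deriv G v) \<le> sqrt B * (1 - norm v) powr (-a/2 - 1)"
    if v: "s1 \<le> norm v" "norm v \<le> norm w" for v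
  proof -
    define x where "x = 1 - norm v"
    define s where "s = (norm v + R) / 2"
    have x: "0 < x" using v w by (simp add: x_def)
    have d: "x/4 \<le> R - s" "x/4 \<le> s - norm v" 
    proof -
      have "R - s = (R - norm v) / 2" "s - norm v = (R - norm v) / 2" by (auto simp: s_def field_simps)
      moreover have "\<delta> \<le> x" using v nw by (simp add: x_def)
      moreover have "norm v = 1 - x" by (simp add: x_def)
      ultimately show "x/4 \<le> R - s" "x/4 \<le> s - norm v" using R by (simp_all add: field_simps)
    qed
    have s: "norm v < s" "s < R" "0 < s" "s < 1" "s1 \<le> s" using v R01 s1 w by (auto simp: s_def)
    have "(norm (deriv G v))\<^sup>2 \<le> (mean_powr 2 R G - mean_powr 2 s G) * (s / (2 * (R - s) * (s - norm v)\<^sup>2))"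
      by (rule norm_deriv_le_mean_powr_2[OF G(2) s(2) G(1) s(1)])
    also have "\<dots> \<le> (2 * e * x powr (1 - a) * (4 powr \<alpha> * \<delta> powr (a - \<alpha>))) * (32 / x ^ 3)"
    proof (intro mult_mono)
      have "mean_powr 2 R G - mean_powr 2 s G \<le> mean_powr p R f - mean_powr p s f"
        using MG[of s] MGR s by simp
      also have "\<dots> \<le> e * ((1 - s\<^sup>2) powr (1 - a) * (1 - R\<^sup>2) powr (a - \<alpha>))"
        using s R01 by (intro incr) auto
      also have "\<dots> \<le> e * ((2 * x powr (1 - a)) * (4 powr \<alpha> * \<delta> powr (a - \<alpha>)))"
      proof (intro mult_left_mono mult_mono Rpow)
        have "1 - s\<^sup>2 = (1 - s) * (1 + s)" by (simp add: algebra_simps power2_eq_square)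
        also have "\<dots> \<le> x * 2" using s x by (intro mult_mono) (auto simp: x_def)
        finally have "(1 - s\<^sup>2) powr (1 - a) \<le> (2 * x) powr (1 - a)"
          using a s by (intro powr_mono2) (auto simp: power_le_one)
        also have "\<dots> = 2 powr (1 - a) * x powr (1 - a)" using x by (simp add: powr_mult)
        also have "\<dots> \<le> 2 powr 1 * x powr (1 - a)" using a by (intro mult_right_mono powr_mono) auto
        finally show "(1 - s\<^sup>2) powr (1 - a) \<le> 2 * x powr (1 - a)" by simp
      qed (use e in auto)
      finally show "mean_powr 2 R G - mean_powr 2 s G \<le> 2 * e * x powr (1 - a) * (4 powr \<alpha> * \<delta> powr (a - \<alpha>))"
        by (simp add: mult_ac)
      have "x/4 * (x/4)\<^sup>2 \<le> (R - s) * (s - norm v)\<^sup>2"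
        using d x s by (intro mult_mono power_mono) auto
      moreover have "x/4 * (x/4)\<^sup>2 = x ^ 3 / 64"
        by (simp add: power2_eq_square power3_eq_cube)
      ultimately have "x ^ 3 / 32 \<le> 2 * ((R - s) * (s - norm v)\<^sup>2)" by linarith
      hence "x ^ 3 / 32 \<le> 2 * (R - s) * (s - norm v)\<^sup>2" by (simp only: mult.assoc)
      hence "s / (2 * (R - s) * (s - norm v)\<^sup>2) \<le> 1 / (x ^ 3 / 32)"
        using s x by (intro frac_le) auto
      thus "s / (2 * (R - s) * (s - norm v)\<^sup>2) \<le> 32 / x ^ 3" by simp
    qed (use s e in auto)
    also have "\<dots> = B * (x powr (1 - a) / x ^ 3)" by (simp add: B_def)
    also have "x powr (1 - a) / x ^ 3 = x powr (- a - 2)"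
    proof -
      have "x powr (1 - a) = x powr (- a - 2) * x powr 3" by (simp flip: powr_add)
      thus ?thesis using x by simp
    qed
    also have "\<dots> = (x powr (-a/2 - 1))\<^sup>2"
      using x by (simp add: power2_eq_square flip: powr_add)
    finally have "(norm (deriv G v))\<^sup>2 \<le> (sqrt B * x powr (-a/2 - 1))\<^sup>2"
      using B0 by (simp add: power_mult_distrib)
    hence "norm (deriv G v) \<le> sqrt B * x powr (-a/2 - 1)"
      by (rule power2_le_imp_le) (use B0 in auto)
    thus ?thesis by (simp add: x_def)
  qed
  \<comment> \<open>The starting value, on the circle of radius \<open>s1\<close>, is bounded by the mean at radius \<open>R\<close>.\<close>
  define v0 where "v0 = of_real (s1 / norm w) * w"
  have "norm w > 0" using w s1 by linarith
  hence v0: "norm v0 = s1" using s1 by (simp add: v0_def norm_mult norm_divide)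
  have base: "(norm (G v0))\<^sup>2 \<le> 2 / (1 - s1) * (mean_powr p s1 f + e * 4 powr \<alpha> * \<delta> powr (a - \<alpha>))"
  proof -
    have s1R: "s1 < R" using R01 w by linarith
    have "(norm (G v0))\<^sup>2 \<le> mean_powr 2 R G * (R / (R - norm v0))"
      by (rule norm_le_mean_powr_2[OF G(2,1)]) (simp add: v0 s1R)
    also have "\<dots> \<le> (mean_powr p s1 f + e * 4 powr \<alpha> * \<delta> powr (a - \<alpha>)) * (2 / (1 - s1))"
    proof (intro mult_mono)
      have "mean_powr 2 R G \<le> mean_powr p s1 f + e * ((1 - s1\<^sup>2) powr (1 - a) * (1 - R\<^sup>2) powr (a - \<alpha>))"
        using incr[of s1 R] s1R R01 MGR by simp
      also have "(1 - s1\<^sup>2) powr (1 - a) * (1 - R\<^sup>2) powr (a - \<alpha>) \<le> 1 * (4 powr \<alpha> * \<delta> powr (a - \<alpha>))"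
        using s1 s1R R01 a by (intro mult_mono Rpow powr_le1) (auto simp: power_le_one)
      finally show "mean_powr 2 R G \<le> mean_powr p s1 f + e * 4 powr \<alpha> * \<delta> powr (a - \<alpha>)"
        using e by simp
      have "R / (R - s1) \<le> 1 / ((1 - s1) / 2)" using R \<delta> R01 s1R by (intro frac_le) auto
      thus "R / (R - norm v0) \<le> 2 / (1 - s1)" by (simp add: v0)
      have "0 \<le> mean_powr p s1 f"
        unfolding mean_powr_def using s1 s1R R01
        by (intro integral_nonneg mean_integrand_integrable[OF f p]) auto
      thus "0 \<le> mean_powr p s1 f + e * 4 powr \<alpha> * \<delta> powr (a - \<alpha>)" using e by simp
      show "0 \<le> R / (R - norm v0)" using R01 s1R v0 by simp
    qed
    finally show ?thesis by (simp add: mult.commute)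
  qed
  have "norm (G w) \<le> norm (G v0) + sqrt B * (2/a) * \<delta> powr (-a/2)"
    unfolding v0_def \<delta>_def
    by (rule norm_le_radial[OF G(2) _ w(2) s1 w(1) a(1) G']) (use R01 G B0 in auto)
  hence "(norm (G w))\<^sup>2 \<le> (norm (G v0) + sqrt B * (2/a) * \<delta> powr (-a/2))\<^sup>2" by (intro power_mono) auto
  also have "\<dots> \<le> 2 * (norm (G v0))\<^sup>2 + 2 * (sqrt B * (2/a) * \<delta> powr (-a/2))\<^sup>2"
  proof -
    have "(x + y)\<^sup>2 \<le> 2 * x\<^sup>2 + 2 * y\<^sup>2" for x y :: real
      using zero_le_power2[of "x - y"] by (simp add: power2_eq_square algebra_simps)
    thus ?thesis .
  qed
  also have "(sqrt B * (2/a) * \<delta> powr (-a/2))\<^sup>2 = B * (4 / a\<^sup>2) * \<delta> powr (-a)"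
    using B0 \<delta> by (simp add: power_mult_distrib power_divide) (simp add: power2_eq_square flip: powr_add)
  also have "B * (4 / a\<^sup>2) * \<delta> powr (-a) = 256 * 4 powr \<alpha> * e / a\<^sup>2 * \<delta> powr (-\<alpha>)"
    using \<delta> by (simp add: B_def flip: powr_add)
  finally have "(norm (G w))\<^sup>2 * \<delta> powr \<alpha> \<le>
      (2 * (2 / (1 - s1) * (mean_powr p s1 f + e * 4 powr \<alpha> * \<delta> powr (a - \<alpha>)))
        + 2 * (256 * 4 powr \<alpha> * e / a\<^sup>2 * \<delta> powr (-\<alpha>))) * \<delta> powr \<alpha>"
    using base by (intro mult_right_mono order_trans[OF _ add_right_mono[OF mult_left_mono[OF base]]]) auto
  also have "\<dots> = 4 / (1 - s1) * (mean_powr p s1 f * \<delta> powr \<alpha> + e * 4 powr \<alpha> * (\<delta> powr (a - \<alpha>) * \<delta> powr \<alpha>))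
    + 512 * 4 powr \<alpha> * e / a\<^sup>2 * (\<delta> powr (-\<alpha>) * \<delta> powr \<alpha>)"
    by (simp add: algebra_simps)
  also have "\<delta> powr (a - \<alpha>) * \<delta> powr \<alpha> = \<delta> powr a" by (simp flip: powr_add)
  also have "\<delta> powr (-\<alpha>) * \<delta> powr \<alpha> = 1" using \<delta> by (simp flip: powr_add)
  finally have "(norm (G w))\<^sup>2 * \<delta> powr \<alpha> \<le>
    4 / (1 - s1) * (mean_powr p s1 f * \<delta> powr \<alpha> + e * 4 powr \<alpha> * \<delta> powr a) + 512 * 4 powr \<alpha> * e / a\<^sup>2"
    by simp
  moreover have "norm (f w) powr p * \<delta> powr \<alpha> \<le> (norm (G w))\<^sup>2 * \<delta> powr \<alpha>"
    using R01 by (intro mult_right_mono fG) auto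
  ultimately show ?thesis unfolding \<delta>_def by linarith
qed

lemma finite_zero_radii:
  assumes f: "f holomorphic_on ball 0 1" and nz: "\<not> (\<forall>z\<in>ball 0 1. f z = 0)" and r: "r < 1"
  shows "finite (norm ` {z. f z = 0} \<inter> {0<..r})"
proof -
  have "finite {z \<in> cball 0 r. f z = 0}"
  proof (cases "f constant_on ball 0 1")
    case True
    then obtain c where c: "\<And>z. z \<in> ball 0 1 \<Longrightarrow> f z = c" by (auto simp: constant_on_def)
    with nz have "c \<noteq> 0" by auto
    with c r have "{z \<in> cball 0 r. f z = 0} = {}" by fastforce
    thus ?thesis by (simp only: finite.emptyI)
  next
    case False
    thus ?thesis using r by (intro holomorphic_compact_finite_zeros[OF f]) auto
  qed
  hence "finite (norm ` {z \<in> cball 0 r. f z = 0})" by simp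
  thus ?thesis by (rule rev_finite_subset) auto
qed

theorem corollary1p4:
  fixes \<alpha> p :: real and f :: "complex \<Rightarrow> complex"
  assumes "0 < \<alpha>" and "0 < p" and "f \<in> A_space \<alpha> p"
  shows "((\<lambda>r. SUP w\<in>sphere 0 r. norm (f w) powr p * (1 - (norm w)\<^sup>2) powr \<alpha>)
           \<longlongrightarrow> 0) (at_left 1)"
proof -
  have f: "f holomorphic_on ball 0 1"
    using assms(3) by (auto simp: A_space_def intro: analytic_imp_holomorphic)
  have sphere_ne: "sphere (0::complex) r \<noteq> {}" if "0 < r" for r
  proof -
    have "of_real r \<in> sphere (0::complex) r" using that by simp
    thus ?thesis by blast
  qed
  have pointwise: "eventually (\<lambda>r. \<forall>w\<in>sphere 0 r. norm (f w) powr p * (1 - (norm w)\<^sup>2) powr \<alpha> \<le> \<eta>) (at_left 1)"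
    if \<eta>: "0 < \<eta>" for \<eta>
  proof (cases "\<forall>z\<in>ball 0 1. f z = 0")
    case True
    have "eventually (\<lambda>r. r < 1) (at_left (1::real))" by (simp add: eventually_at_filter)
    thus ?thesis by eventually_elim (use True \<eta> in auto)
  next
    case False
    \<comment> \<open>Both exponents \<open>1 - a\<close> and \<open>\<alpha> - a\<close> must be nonnegative and \<open>a\<close> positive.\<close>
    define a where "a = min \<alpha> 1"
    have a: "0 < a" "a \<le> 1" "a \<le> \<alpha>" using assms by (auto simp: a_def)
    \<comment> \<open>This choice makes the last term of the growth estimate, multiplied by
      \<open>2 powr \<alpha>\<close>, equal to \<open>\<eta> / 2\<close>.\<close>
    define e where "e = \<eta> * a\<^sup>2 / (1024 * 8 powr \<alpha>)"
    have e: "0 < e" using \<eta> a by (simp add: e_def)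
    note zero_radii = finite_zero_radii[OF f False]
    define Z where "Z = norm ` {z. f z = 0}"
    have fin: "(\<integral>\<^sup>+ r\<in>{0<..<1}. ennreal (deriv (\<lambda>s. mean_powr p s f) r * (1 - r\<^sup>2) powr (\<alpha> - 1)) \<partial>lborel) < \<infinity>"
      using assms(3) by (auto simp: A_space_def A_norm_powr_def ennreal_add_less_top)
    have "\<exists>s0\<in>{0<..<1}. \<forall>s R. s0 < s \<longrightarrow> s \<le> R \<longrightarrow> R < 1 \<longrightarrow>
           mean_powr p R f - mean_powr p s f \<le> e * ((1 - s\<^sup>2) powr (1 - a) * (1 - R\<^sup>2) powr (a - \<alpha>))"
    proof (rule increment_bound_of_weighted_deriv[where Z = Z, OF _ _ _ _ fin a(2,3) e])
      show "continuous_on {0<..<1} (\<lambda>r. mean_powr p r f)"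
        by (rule continuous_on_subset[OF continuous_on_mean_powr[OF f assms(2)]]) auto
      show "finite (Z \<inter> {0<..r})" if "r < 1" for r using zero_radii[OF that] by (simp add: Z_def)
      fix r assume r: "r \<in> {0<..<1} - Z"
      hence nz: "f z \<noteq> 0" if "norm z = r" for z using that by (auto simp: Z_def)
      show "((\<lambda>s. mean_powr p s f) has_real_derivative deriv (\<lambda>s. mean_powr p s f) r) (at r)"
        using r by (intro field_differentiable_derivI mean_powr_differentiable f assms nz) auto
      show "0 \<le> deriv (\<lambda>s. mean_powr p s f) r"
        using r by (intro deriv_mean_powr_nonneg f assms nz) auto
    qed
    then obtain s0 where s0: "0 < s0" "s0 < 1" and incr: "\<And>s R. s0 < s \<Longrightarrow> s \<le> R \<Longrightarrow> R < 1 \<Longrightarrow>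
           mean_powr p R f - mean_powr p s f \<le> e * ((1 - s\<^sup>2) powr (1 - a) * (1 - R\<^sup>2) powr (a - \<alpha>))"
      by auto
    define s1 where "s1 = (s0 + 1) / 2"
    have s1: "s0 < s1" "0 < s1" "s1 < 1" using s0 by (auto simp: s1_def)
    define H where "H r = 2 powr \<alpha> * (4 / (1 - s1) * (mean_powr p s1 f * (1 - r) powr \<alpha> + e * 4 powr \<alpha> * (1 - r) powr a))"
      for r :: real
    have bound: "norm (f w) powr p * (1 - (norm w)\<^sup>2) powr \<alpha> \<le> H (norm w) + \<eta> / 2"
      if w: "s1 < norm w" "norm w < 1" for w
    proof -
      have "(1 - (norm w)\<^sup>2) powr \<alpha> \<le> (2 * (1 - norm w)) powr \<alpha>"
      proof (rule powr_mono2)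
        have "(1 - norm w) * (1 + norm w) \<le> (1 - norm w) * 2" using w by (intro mult_left_mono) auto
        thus "1 - (norm w)\<^sup>2 \<le> 2 * (1 - norm w)" by (simp add: algebra_simps power2_eq_square)
        show "0 \<le> 1 - (norm w)\<^sup>2" using w by (simp add: power_le_one)
      qed (use assms in auto)
      also have "\<dots> = 2 powr \<alpha> * (1 - norm w) powr \<alpha>" using w by (subst powr_mult) auto
      finally have "(1 - (norm w)\<^sup>2) powr \<alpha> \<le> 2 powr \<alpha> * (1 - norm w) powr \<alpha>" .
      from mult_left_mono[OF this, of "norm (f w) powr p"]
      have "norm (f w) powr p * (1 - (norm w)\<^sup>2) powr \<alpha> \<le>
          2 powr \<alpha> * (norm (f w) powr p * (1 - norm w) powr \<alpha>)"
        by (simp add: mult.left_commute)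
      also have "\<dots> \<le> 2 powr \<alpha> * (4 / (1 - s1) * (mean_powr p s1 f * (1 - norm w) powr \<alpha> + e * 4 powr \<alpha> * (1 - norm w) powr a)
          + 512 * 4 powr \<alpha> * e / a\<^sup>2)"
        using s1 by (intro mult_left_mono growth_estimate[OF f assms(2) zero_radii a e s1(2) incr w]) auto
      also have "\<dots> = H (norm w) + 512 * (2 powr \<alpha> * 4 powr \<alpha>) * e / a\<^sup>2"
        by (simp add: H_def algebra_simps)
      also have "(2::real) powr \<alpha> * 4 powr \<alpha> = 8 powr \<alpha>" by (simp flip: powr_mult)
      also have "512 * 8 powr \<alpha> * e / a\<^sup>2 = \<eta> / 2" using a by (simp add: e_def)
      finally show ?thesis .
    qed
    have "(H \<longlongrightarrow> 2 powr \<alpha> * (4 / (1 - s1) * (mean_powr p s1 f * 0 + e * 4 powr \<alpha> * 0))) (at_left 1)"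
    proof -
      have "((\<lambda>r::real. (1 - r) powr b) \<longlongrightarrow> 0) (at_left 1)" if "0 < b" for b
      proof -
        have "((\<lambda>r::real. (1 - r) powr b) \<longlongrightarrow> (1 - 1) powr b) (at_left 1)"
          using that by (intro tendsto_intros tendsto_powr') (auto simp: eventually_at_filter)
        thus ?thesis by simp
      qed
      from this[OF assms(1)] this[OF a(1)] show ?thesis unfolding H_def by (intro tendsto_intros)
    qed
    hence "(H \<longlongrightarrow> 0) (at_left 1)" by simp
    hence "eventually (\<lambda>r. H r < \<eta> / 2) (at_left 1)" using \<eta> by (intro order_tendstoD) auto
    moreover have "eventually (\<lambda>r. r \<in> {s1<..<1}) (at_left 1)"
      using s1 by (intro eventually_at_leftI) auto
    ultimately show ?thesis
    proof eventually_elim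
      case (elim r)
      show ?case
      proof
        fix w :: complex assume "w \<in> sphere 0 r"
        hence "norm w = r" by simp
        with bound[of w] elim show "norm (f w) powr p * (1 - (norm w)\<^sup>2) powr \<alpha> \<le> \<eta>" by auto
      qed
    qed
  qed
  show ?thesis
  proof (rule tendstoI)
    fix \<eta> :: real assume \<eta>: "0 < \<eta>"
    have "eventually (\<lambda>r. r \<in> {0<..<1}) (at_left (1::real))" by (intro eventually_at_leftI) auto
    moreover have "0 < \<eta> / 2" using \<eta> by simp
    note pointwise[OF this]
    ultimately show "eventually (\<lambda>r. dist (SUP w\<in>sphere 0 r. norm (f w) powr p * (1 - (norm w)\<^sup>2) powr \<alpha>) 0 < \<eta>) (at_left 1)"
    proof eventually_elim
      case (elim r)
      let ?u = "\<lambda>w. norm (f w) powr p * (1 - (norm w)\<^sup>2) powr \<alpha>"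
      have ne: "sphere (0::complex) r \<noteq> {}" using elim by (intro sphere_ne) auto
      then obtain w0 where w0: "w0 \<in> sphere (0::complex) r" by blast
      have "bdd_above (?u ` sphere 0 r)" using elim by (intro bdd_aboveI2[where M = "\<eta> / 2"]) auto
      hence "?u w0 \<le> (SUP w\<in>sphere 0 r. ?u w)" by (rule cSUP_upper[OF w0])
      moreover have "0 \<le> ?u w0" by simp
      moreover have "(SUP w\<in>sphere 0 r. ?u w) \<le> \<eta> / 2" using ne elim by (intro cSUP_least) auto
      ultimately have "\<bar>SUP w\<in>sphere 0 r. ?u w\<bar> < \<eta>" using \<eta> by linarith
      thus ?case by (simp add: dist_real_def)
    qed
  qed
qed

end
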